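(* For every integer $t\neq 0$, let $N_t=\begin{pmatrix}4&2t\\0&4\end{pmatrix}$. Then the matrices $$A_t=\begin{pmatrix}0&t\\0&0\end{pmatrix},\quad B_t=\begin{pmatrix}0&2t\\0&12\end{pmatrix},\quad C_t=\begin{pmatrix}3&2t\\0&1\end{pmatrix},\quad D_t=\begin{pmatrix}7&t\\0&5\end{pmatrix}$$ form an upper-triangular Jordan $D(N_t)$-quadruple.
   Context: $UT_2(\mathbb{Z})$ denotes the ring of upper-triangular $2\times 2$ integer matrices, and $A\circ B=\frac12(AB+BA)$ (computed over $\mathbb{Q}$) is the Jordan product. For $N\in UT_2(\mathbb{Z})$, an upper-triangular Jordan $D(N)$-quadruple is a set of four distinct nonzero matrices $A_1,A_2,A_3,A_4\in UT_2(\mathbb{Z})$ such that for every $1\le i<j\le 4$ there exists $X_{ij}\in UT_2(\mathbb{Z})$ with $A_i\circ A_j+N=X_{ij}^2$. *)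

theory Defs
  imports "HOL-Analysis.Analysis"
begin

(* The multiplication instance on the vector types is entrywise; the ring product
   of matrices is (**), so squares are written X ** X. *)

definition UT2 :: "(int^2^2) set" where
  "UT2 = {A. A $ 2 $ 1 = 0}"

definition ut :: "int \<Rightarrow> int \<Rightarrow> int \<Rightarrow> int^2^2" where
  "ut a b d = vector [vector [a, b], vector [0, d]]"

abbreviation rat_matrix :: "int^2^2 \<Rightarrow> rat^2^2" where
  "rat_matrix \<equiv> map_matrix of_int"

definition jordan_prod :: "rat^2^2 \<Rightarrow> rat^2^2 \<Rightarrow> rat^2^2" where
  "jordan_prod A B = map_matrix (\<lambda>x. 1/2 * x) (A ** B + B ** A)"

(* jordan_prod is symmetric, so the choice of the enumeration A of S is immaterial. *)

definition jordan_D_quadruple :: "int^2^2 \<Rightarrow> (int^2^2) set \<Rightarrow> bool" where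
  "jordan_D_quadruple N S \<longleftrightarrow>
     N \<in> UT2 \<and>
     (\<exists>A :: nat \<Rightarrow> int^2^2.
        inj_on A {1..4} \<and> S = A ` {1..4} \<and>
        (\<forall>i\<in>{1..4}. A i \<in> UT2 \<and> A i \<noteq> 0) \<and>
        (\<forall>i j. 1 \<le> i \<and> i < j \<and> j \<le> 4 \<longrightarrow>
           (\<exists>X\<in>UT2. jordan_prod (rat_matrix (A i)) (rat_matrix (A j)) + rat_matrix N
                    = rat_matrix (X ** X))))"

end

theory Submission
  imports Defs
begin

text \<open>
  For upper-triangular matrices with rows \<open>(a, b)\<close>, \<open>(0, d)\<close> and \<open>(a', b')\<close>, \<open>(0, d')\<close> the Jordan
  product is again upper triangular, with diagonal entries \<open>a a'\<close> and \<open>d d'\<close> and corner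
  \<open>(b' (a + d) + b (a' + d')) / 2\<close>, while the square of the matrix with rows \<open>(x, z)\<close>, \<open>(0, y)\<close>
  has diagonal \<open>x\<^sup>2\<close>, \<open>y\<^sup>2\<close> and corner \<open>z (x + y)\<close>. Being a square after the shift by \<open>N\<close> is thus
  three integer equations (\<open>jordan_prod_ut_plus_eq_square\<close>). Here the two diagonal equations do
  not involve \<open>t\<close>: the first diagonal entries \<open>0, 0, 3, 7\<close> and the second ones \<open>0, 12, 1, 5\<close> are
  both such that every product of two of them, increased by 4, is a perfect square. Choosing the
  positive square roots for \<open>x\<close> and \<open>y\<close>, the corner equation is linear in \<open>z\<close>, and its solution is
  \<open>t\<close>, \<open>2 t\<close> or \<open>3 t\<close> because all corners are multiples of \<open>t\<close> and the division by \<open>x + y\<close> is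
  exact.
\<close>

lemma ut_in_UT2: "ut a b d \<in> UT2"
  by (simp add: UT2_def ut_def)

lemma ut_eq_iff: "ut a b d = ut a' b' d' \<longleftrightarrow> a = a' \<and> b = b' \<and> d = d'"
  by (auto simp: ut_def vec_eq_iff forall_2)

lemma ut_eq_0_iff: "ut a b d = 0 \<longleftrightarrow> a = 0 \<and> b = 0 \<and> d = 0"
  by (auto simp: ut_def vec_eq_iff forall_2)

text \<open>
  The corner equation is stated after doubling, so that all three hypotheses are equations between
  integers although the Jordan product itself may have a half-integral corner.
\<close>

lemma jordan_prod_ut_plus_eq_square:
  assumes "a * a' + n = x\<^sup>2" and "d * d' + n' = y\<^sup>2"
    and "b' * (a + d) + b * (a' + d') + 2 * m = 2 * (z * (x + y))"
  shows "jordan_prod (rat_matrix (ut a b d)) (rat_matrix (ut a' b' d')) + rat_matrix (ut n m n')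
         = rat_matrix (ut x z y ** ut x z y)"
proof -
  have "of_int (a * a' + n) = (of_int (x * x) :: rat)"
    and "of_int (d * d' + n') = (of_int (y * y) :: rat)"
    and "of_int (b' * (a + d) + b * (a' + d') + 2 * m) = (of_int (2 * (z * (x + y))) :: rat)"
    using assms by (simp_all only: power2_eq_square)
  then show ?thesis
    by (simp add: jordan_prod_def ut_def map_matrix_def matrix_matrix_mult_def vec_eq_iff
        forall_2 sum_2 field_simps)
qed

theorem proposition16:
  fixes t :: int
  assumes "t \<noteq> 0"
  shows "jordan_D_quadruple (ut 4 (2 * t) 4)
           {ut 0 t 0, ut 0 (2 * t) 12, ut 3 (2 * t) 1, ut 7 t 5}"
proof -
  define A where "A i = (if i = 1 then ut 0 t 0 else if i = 2 then ut 0 (2 * t) 12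
    else if i = 3 then ut 3 (2 * t) 1 else ut 7 t 5)" for i :: nat
  have A: "A 1 = ut 0 t 0" "A 2 = ut 0 (2 * t) 12" "A 3 = ut 3 (2 * t) 1" "A 4 = ut 7 t 5"
    by (simp_all add: A_def)
  have indices: "{1..4} = {1, 2, 3, 4 :: nat}"
    by auto
  let ?sq = "\<lambda>i j. \<exists>X\<in>UT2. jordan_prod (rat_matrix (A i)) (rat_matrix (A j))
    + rat_matrix (ut 4 (2 * t) 4) = rat_matrix (X ** X)"
  have sq12: "?sq 1 2" unfolding A
    by (rule bexI[of _ "ut 2 (2 * t) 2"], rule jordan_prod_ut_plus_eq_square)
      (simp_all add: ut_in_UT2)
  have sq13: "?sq 1 3" unfolding A
    by (rule bexI[of _ "ut 2 t 2"], rule jordan_prod_ut_plus_eq_square)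
      (simp_all add: ut_in_UT2)
  have sq14: "?sq 1 4" unfolding A
    by (rule bexI[of _ "ut 2 (2 * t) 2"], rule jordan_prod_ut_plus_eq_square)
      (simp_all add: ut_in_UT2)
  have sq23: "?sq 2 3" unfolding A
    by (rule bexI[of _ "ut 2 (3 * t) 4"], rule jordan_prod_ut_plus_eq_square)
      (simp_all add: ut_in_UT2)
  have sq24: "?sq 2 4" unfolding A
    by (rule bexI[of _ "ut 2 (2 * t) 8"], rule jordan_prod_ut_plus_eq_square)
      (simp_all add: ut_in_UT2)
  have sq34: "?sq 3 4" unfolding A
    by (rule bexI[of _ "ut 5 (2 * t) 3"], rule jordan_prod_ut_plus_eq_square)
      (simp_all add: ut_in_UT2)
  have "?sq i j" if "1 \<le> i" "i < j" "j \<le> 4" for i j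
  proof -
    have "i = 1 \<and> j = 2 \<or> i = 1 \<and> j = 3 \<or> i = 1 \<and> j = 4
        \<or> i = 2 \<and> j = 3 \<or> i = 2 \<and> j = 4 \<or> i = 3 \<and> j = 4"
      using that by linarith
    then show ?thesis
      using sq12 sq13 sq14 sq23 sq24 sq34 by blast
  qed
  moreover have "inj_on A {1..4}"
    unfolding indices by (simp add: A_def ut_eq_iff)
  moreover have "{ut 0 t 0, ut 0 (2 * t) 12, ut 3 (2 * t) 1, ut 7 t 5} = A ` {1..4}"
    unfolding indices by (auto simp: A_def)
  moreover have "\<forall>i\<in>{1..4}. A i \<in> UT2 \<and> A i \<noteq> 0"
    using assms by (simp add: A_def ut_in_UT2 ut_eq_0_iff)
  ultimately show ?thesis
    unfolding jordan_D_quadruple_def using ut_in_UT2 by blast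
qed

end
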